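(* Let $K\subset\mathbb{R}^n$ be a strictly convex body with $C^1$-boundary, let $\nu\in\mathbb{S}^{n-1}$, and let $h_\nu$ be the slicing support function of $K$. Let $u\in\nu^\perp$ with $u\ne 0$, and assume $m<p<M$, where $m=\min_{x\in K}x\cdot\nu$ and $M=\max_{x\in K}x\cdot\nu$. Then $$h_K\bigl(u-\partial_p h_\nu(u,p)\,\nu\bigr)=h_\nu(u,p)-p\,\partial_p h_\nu(u,p),$$ where $\partial_p h_\nu(u,p)$ denotes the partial derivative of $h_\nu$ with respect to $p$.
   Context: For a convex body $K\subset\mathbb{R}^n$, the support function is $h_K(v)=\sup_{x\in K}x\cdot v$, $v\in\mathbb{R}^n$. For a unit vector $\nu\in\mathbb{S}^{n-1}$ write $\nu^\perp=\{x\in\mathbb{R}^n: x\cdot\nu=0\}$, and for $p\in\mathbb{R}$ let $C(\nu,p)=K\cap\{x\in\mathbb{R}^n: x\cdot\nu=p\}$. The slicing support function is $h_\nu(u,p)=\sup_{x\in C(\nu,p)}x\cdot u$ for $u\in\nu^\perp$, $p\in\mathbb{R}$, with the convention $h_\nu(u,p)=-\infty$ if $C(\nu,p)=\emptyset$. *)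

theory Defs
  imports "HOL-Analysis.Analysis"
begin

definition convex_body :: "'a::euclidean_space set \<Rightarrow> bool" where
  "convex_body K \<longleftrightarrow> compact K \<and> convex K \<and> interior K \<noteq> {}"

definition strictly_convex_set :: "'a::euclidean_space set \<Rightarrow> bool" where
  "strictly_convex_set K \<longleftrightarrow>
     (\<forall>x\<in>K. \<forall>y\<in>K. x \<noteq> y \<longrightarrow> open_segment x y \<subseteq> interior K)"

text \<open>
  The boundary is \<open>C\<^sup>1\<close> if, near each boundary point, the set is the sublevel set of a
  continuously differentiable function \<open>g\<close> with nowhere vanishing gradient \<open>G\<close>.
\<close>

definition C1_boundary :: "'a::euclidean_space set \<Rightarrow> bool" where
  "C1_boundary K \<longleftrightarrow>
     (\<forall>x\<in>frontier K. \<exists>U (g :: 'a \<Rightarrow> real) (G :: 'a \<Rightarrow> 'a).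
        open U \<and> x \<in> U \<and>
        (\<forall>y\<in>U. (g has_derivative (\<lambda>w. G y \<bullet> w)) (at y)) \<and>
        continuous_on U G \<and>
        (\<forall>y\<in>U. G y \<noteq> 0) \<and>
        K \<inter> U = {y \<in> U. g y \<le> 0})"

definition support_function :: "'a::euclidean_space set \<Rightarrow> 'a \<Rightarrow> real" where
  "support_function K v = (SUP x\<in>K. x \<bullet> v)"

definition slice :: "'a::euclidean_space set \<Rightarrow> 'a \<Rightarrow> real \<Rightarrow> 'a set" where
  "slice K \<nu> p = K \<inter> {x. x \<bullet> \<nu> = p}"

text \<open>The supremum is taken in \<^typ>\<open>ereal\<close>, so it equals \<open>-\<infinity>\<close> on an empty slice.\<close>

definition slicing_support_function ::
    "'a::euclidean_space set \<Rightarrow> 'a \<Rightarrow> 'a \<Rightarrow> real \<Rightarrow> ereal" where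
  "slicing_support_function K \<nu> u p = (SUP x\<in>slice K \<nu> p. ereal (x \<bullet> u))"

text \<open>
  An extended-real-valued function is differentiable at \<open>p\<close> if it is finite in a
  neighbourhood of \<open>p\<close> and differentiable at \<open>p\<close> as a real-valued function. The derivative
  below is meaningful only in that case.
\<close>

definition ereal_differentiable_at :: "(real \<Rightarrow> ereal) \<Rightarrow> real \<Rightarrow> bool" where
  "ereal_differentiable_at f p \<longleftrightarrow>
     (\<forall>\<^sub>F q in nhds p. \<bar>f q\<bar> \<noteq> \<infinity>) \<and>
     (\<lambda>q. real_of_ereal (f q)) differentiable (at p)"

definition ereal_deriv :: "(real \<Rightarrow> ereal) \<Rightarrow> real \<Rightarrow> real" where
  "ereal_deriv f p = deriv (\<lambda>q. real_of_ereal (f q)) p"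

end

theory Submission
  imports Defs
begin

text \<open>
  Let \<open>x\<close> maximise \<open>x \<bullet> u\<close> on the slice at height \<open>p\<close>. Then \<open>x\<close> is a boundary point, and the
  gradient \<open>n\<close> there is an outer normal of \<open>K\<close> such that every direction \<open>w\<close> with \<open>n \<bullet> w < 0\<close>
  points into \<open>K\<close>. Maximality of \<open>x\<close> within its slice, together with \<open>m < p < M\<close>, forces \<open>n\<close> to be
  a positive multiple of \<open>u - s \<nu>\<close> for some \<open>s\<close>. The supporting hyperplane at \<open>x\<close> with this
  normal gives \<open>h\<^sub>K (u - s \<nu>) = x \<bullet> u - s p\<close> and the upper bound
  \<open>h\<^sub>\<nu>(u,q) \<le> h\<^sub>\<nu>(u,p) + s (q - p)\<close>, while moving from \<open>x\<close> along
  \<open>\<nu> + (s - \<epsilon>) u / \<bar>u\<bar>\<^sup>2\<close> or \<open>- \<nu> - (s + \<epsilon>) u / \<bar>u\<bar>\<^sup>2\<close> gives the matching lower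
  bound up to \<open>\<epsilon> \<bar>q - p\<bar>\<close>. Hence \<open>s\<close> is the derivative.
\<close>

section \<open>Normals at smooth boundary points, and half-spaces\<close>

text \<open>The gradient of the local defining function at \<open>x\<close> serves as
  \<open>n\<close>. Convexity carries the first inequality from the neighbourhood to all of
  \<open>K\<close>. The second conclusion expresses smoothness: no \<open>n\<close> satisfies it at
  a corner.\<close>

lemma C1_boundary_normal:
  fixes K :: "'a::euclidean_space set"
  assumes C1: "C1_boundary K" and K: "closed K" "convex K" and x: "x \<in> frontier K"
  obtains n where "n \<noteq> 0"
    and "\<And>y. y \<in> K \<Longrightarrow> n \<bullet> (y - x) \<le> 0"
    and "\<And>w. n \<bullet> w < 0 \<Longrightarrow> \<forall>\<^sub>F t in at_right 0. x + t *\<^sub>R w \<in> K"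
proof -
  obtain U g G where U: "open U" "x \<in> U"
    and g: "\<forall>y\<in>U. (g has_derivative (\<lambda>w. G y \<bullet> w)) (at y)"
    and "continuous_on U G"
    and G: "\<forall>y\<in>U. G y \<noteq> 0"
    and KU: "K \<inter> U = {y \<in> U. g y \<le> 0}"
    using bspec[OF C1[unfolded C1_boundary_def] x] by (elim exE conjE) (rule that)
  have xK: "x \<in> K"
    using x K(1) frontier_subset_closed by blast
  \<comment> \<open>If \<open>g x\<close> were negative, \<open>g\<close> would stay negative nearby
    by continuity, and \<open>x\<close> would be interior.\<close>
  have gx: "g x = 0"
  proof (rule ccontr)
    assume "g x \<noteq> 0"
    moreover have "g x \<le> 0"
      using xK U KU by blast
    moreover have "(g \<longlongrightarrow> g x) (nhds x)"
      using has_derivative_continuous[OF bspec[OF g U(2)]]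
      by (simp add: continuous_within tendsto_at_iff_tendsto_nhds)
    ultimately have "\<forall>\<^sub>F y in nhds x. g y < 0"
      using order_tendstoD(2) by fastforce
    moreover have "\<forall>\<^sub>F y in nhds x. y \<in> U"
      using U by (rule eventually_nhds_in_open)
    ultimately have "\<forall>\<^sub>F y in nhds x. y \<in> K"
      by eventually_elim (use KU in force)
    then show False
      using x unfolding frontier_def eventually_nhds interior_def by blast
  qed
  have inU: "\<forall>\<^sub>F t in at_right 0. x + t *\<^sub>R w \<in> U" for w
  proof -
    have "((\<lambda>t. x + t *\<^sub>R w) \<longlongrightarrow> x + 0 *\<^sub>R w) (at_right 0)"
      by (intro tendsto_intros)
    then show ?thesis
      using U by (auto simp: tendsto_def)
  qed
  have deriv: "((\<lambda>t. g (x + t *\<^sub>R w)) has_real_derivative G x \<bullet> w) (at 0)" for w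
  proof -
    have "((\<lambda>t. x + t *\<^sub>R w) has_derivative (\<lambda>t. t *\<^sub>R w)) (at 0)"
      by (auto intro!: derivative_eq_intros)
    moreover have "(g has_derivative (\<lambda>w. G x \<bullet> w)) (at (x + 0 *\<^sub>R w))"
      using g U by simp
    ultimately have "((\<lambda>t. g (x + t *\<^sub>R w)) has_derivative (\<lambda>t. G x \<bullet> (t *\<^sub>R w))) (at 0)"
      by (rule has_derivative_compose)
    then show ?thesis
      by (simp add: has_field_derivative_def mult.commute[of _ "G x \<bullet> w"] fun_eq_iff)
  qed
  show thesis
  proof
    show "G x \<noteq> 0"
      using G U by blast
  next
    fix y assume y: "y \<in> K"
    show "G x \<bullet> (y - x) \<le> 0"
    proof (rule ccontr)
      assume "\<not> G x \<bullet> (y - x) \<le> 0"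
      \<comment> \<open>Otherwise \<open>g\<close> becomes positive at once on the way from
        \<open>x\<close> to \<open>y\<close>, although that segment lies in
        \<open>K\<close>.\<close>
      then obtain d where d: "d > 0" "\<And>t. 0 < t \<Longrightarrow> t < d \<Longrightarrow> g x < g (x + t *\<^sub>R (y - x))"
        using has_real_derivative_pos_inc_right[OF deriv[of "y - x"]] by force
      have "\<forall>\<^sub>F t in at_right (0::real). t < min d 1"
        using d by (intro order_tendstoD(2)[OF tendsto_ident_at]) auto
      then have "\<forall>\<^sub>F t in at_right (0::real). False"
        using inU[of "y - x"] eventually_at_right_less[of 0]
      proof eventually_elim
        case (elim t)
        have "(1 - t) *\<^sub>R x + t *\<^sub>R y \<in> K"
          using elim K(2) xK y by (intro convexD) auto
        then have "x + t *\<^sub>R (y - x) \<in> K"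
          by (simp add: algebra_simps)
        then have "g (x + t *\<^sub>R (y - x)) \<le> 0"
          using KU elim by blast
        then show False
          using d(2)[of t] elim gx by simp
      qed
      then show False
        by simp
    qed
  next
    fix w assume "G x \<bullet> w < 0"
    then obtain d where d: "d > 0" "\<And>t. 0 < t \<Longrightarrow> t < d \<Longrightarrow> g (x + t *\<^sub>R w) < g x"
      using has_real_derivative_neg_dec_right[OF deriv[of w]] by force
    have "\<forall>\<^sub>F t in at_right (0::real). t < d"
      using d by (intro order_tendstoD(2)[OF tendsto_ident_at]) auto
    then show "\<forall>\<^sub>F t in at_right 0. x + t *\<^sub>R w \<in> K"
      using inU[of w] eventually_at_right_less[of 0]
    proof eventually_elim
      case (elim t)
      then have "g (x + t *\<^sub>R w) \<le> 0"
        using d(2)[of t] gx by simp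
      then show ?case
        using elim KU by blast
    qed
  qed
qed

text \<open>The part \<open>v\<close> of \<open>u\<close> orthogonal to \<open>a\<close> must
  vanish, and testing with \<open>- a\<close> then fixes the sign. All test directions lie in the
  span, so the lemma applies when only directions parallel to a slice are available.\<close>

lemma positive_multiple_of_halfspace:
  fixes a u :: "'a::real_inner"
  assumes "a \<noteq> 0" "u \<noteq> 0"
    and le: "\<And>w. w \<in> span {a, u} \<Longrightarrow> a \<bullet> w < 0 \<Longrightarrow> u \<bullet> w \<le> 0"
  obtains c where "c > 0" "a = c *\<^sub>R u"
proof -
  define b where "b = (u \<bullet> a) / (a \<bullet> a)"
  define v where "v = u - b *\<^sub>R a"
  have aa: "a \<bullet> a > 0"
    using assms by simp
  have av: "a \<bullet> v = 0"
    using aa by (simp add: v_def b_def inner_simps inner_commute)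
  have uv: "u \<bullet> v = v \<bullet> v"
    using av by (simp add: v_def inner_simps inner_commute)
  have sp: "a \<in> span {a, u}" "u \<in> span {a, u}"
    by (simp_all add: span_base)
  \<comment> \<open>The direction \<open>v\<close> only satisfies \<open>a \<bullet> v = 0\<close>;
    tilting it by a small multiple of \<open>- a\<close> makes the inequality strict, and \<epsilon>
    tends to 0 afterwards.\<close>
  have "v \<bullet> v \<le> \<epsilon> * (u \<bullet> a)" if "\<epsilon> > 0" for \<epsilon>
  proof -
    have "v - \<epsilon> *\<^sub>R a \<in> span {a, u}"
      unfolding v_def using sp by (intro span_diff span_scale)
    moreover have "a \<bullet> (v - \<epsilon> *\<^sub>R a) < 0"
      using that aa av by (simp add: inner_simps)
    ultimately show ?thesis
      using le uv by (fastforce simp: inner_simps)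
  qed
  then have "\<forall>\<^sub>F \<epsilon> in at_right 0. v \<bullet> v \<le> \<epsilon> * (u \<bullet> a)"
    using eventually_at_right_less[of "0::real"] by (auto elim: eventually_mono)
  moreover have "((\<lambda>\<epsilon>. \<epsilon> * (u \<bullet> a)) \<longlongrightarrow> 0 * (u \<bullet> a)) (at_right 0)"
    by (intro tendsto_intros)
  ultimately have "v \<bullet> v \<le> 0 * (u \<bullet> a)"
    by (intro tendsto_lowerbound) auto
  then have u: "u = b *\<^sub>R a"
    by (simp add: v_def not_less[symmetric])
  moreover have "u \<bullet> (- a) \<le> 0"
    using aa sp by (intro le span_neg) auto
  ultimately have "b > 0"
    using aa \<open>u \<noteq> 0\<close> by (cases "b = 0") (auto simp: zero_le_mult_iff)
  with u show thesis
    by (intro that[of "inverse b"]) auto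
qed

section \<open>Maximisers on a slice and their normals\<close>

lemma slice_maximum:
  fixes K :: "'a::euclidean_space set"
  assumes "compact K" "slice K \<nu> p \<noteq> {}"
  obtains x where "x \<in> slice K \<nu> p" "\<And>y. y \<in> slice K \<nu> p \<Longrightarrow> y \<bullet> u \<le> x \<bullet> u"
proof -
  have "closed {x. x \<bullet> \<nu> = p}"
    using closed_hyperplane[of \<nu> p] by (simp add: inner_commute)
  then have "compact (slice K \<nu> p)"
    unfolding slice_def using assms(1) by (rule compact_Int_closed[rotated])
  moreover have "continuous_on (slice K \<nu> p) (\<lambda>x. x \<bullet> u)"
    by (intro continuous_intros)
  ultimately show thesis
    using continuous_attains_sup[OF _ assms(2)] that by blast
qed

lemma slicing_support_maximum:
  assumes "x \<in> slice K \<nu> p" "\<And>y. y \<in> slice K \<nu> p \<Longrightarrow> y \<bullet> u \<le> x \<bullet> u"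
  shows "slicing_support_function K \<nu> u p = ereal (x \<bullet> u)"
  unfolding slicing_support_function_def
  by (rule antisym) (use assms in \<open>auto intro!: SUP_least SUP_upper\<close>)

text \<open>The normal is rescaled so that its component orthogonal to \<nu> is exactly
  \<open>u\<close>; the remaining coefficient gives \<open>s\<close>, the future derivative.\<close>

lemma slicing_support_normal:
  fixes K :: "'a::euclidean_space set"
  assumes K: "closed K" "convex K" "C1_boundary K"
    and \<nu>: "norm \<nu> = 1" and u: "u \<bullet> \<nu> = 0" "u \<noteq> 0"
    and y: "y \<in> K" "y \<bullet> \<nu> < p" and z: "z \<in> K" "p < z \<bullet> \<nu>"
    and x: "x \<in> slice K \<nu> p" and max: "\<And>y. y \<in> slice K \<nu> p \<Longrightarrow> y \<bullet> u \<le> x \<bullet> u"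
  obtains s where "\<And>y. y \<in> K \<Longrightarrow> y \<bullet> (u - s *\<^sub>R \<nu>) \<le> x \<bullet> (u - s *\<^sub>R \<nu>)"
    and "\<And>w. w \<bullet> (u - s *\<^sub>R \<nu>) < 0 \<Longrightarrow> \<forall>\<^sub>F t in at_right 0. x + t *\<^sub>R w \<in> K"
proof -
  have xK: "x \<in> K" and xp: "x \<bullet> \<nu> = p"
    using x by (auto simp: slice_def)
  have \<nu>\<nu>: "\<nu> \<bullet> \<nu> = 1"
    using \<nu> by (simp add: dot_square_norm)
  have maximal: "w \<bullet> u \<le> 0" if "\<forall>\<^sub>F t in at_right 0. x + t *\<^sub>R w \<in> K" "w \<bullet> \<nu> = 0" for w
  proof -
    have "\<forall>\<^sub>F t in at_right (0::real). w \<bullet> u \<le> 0"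
      using that(1) eventually_at_right_less[of 0]
    proof eventually_elim
      case (elim t)
      then have "x + t *\<^sub>R w \<in> slice K \<nu> p"
        using that(2) xp by (simp add: slice_def inner_simps)
      from max[OF this] elim show ?case
        by (simp add: inner_simps mult_le_0_iff)
    qed
    then show ?thesis
      by simp
  qed
  \<comment> \<open>From an interior point one could move along \<open>u\<close> inside the slice
    and increase the product with \<open>u\<close>.\<close>
  have "x \<notin> interior K"
  proof
    assume "x \<in> interior K"
    moreover have "((\<lambda>t. x + t *\<^sub>R u) \<longlongrightarrow> x + 0 *\<^sub>R u) (at_right 0)"
      by (intro tendsto_intros)
    ultimately have "\<forall>\<^sub>F t in at_right 0. x + t *\<^sub>R u \<in> interior K"
      by (auto simp: tendsto_def)
    then have "\<forall>\<^sub>F t in at_right 0. x + t *\<^sub>R u \<in> K"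
      by (rule eventually_mono) (use interior_subset in blast)
    then show False
      using maximal[of u] u by (simp add: not_less[symmetric])
  qed
  then have "x \<in> frontier K"
    using K(1) xK by (simp add: frontier_def)
  then obtain n where n: "n \<noteq> 0" "\<And>y. y \<in> K \<Longrightarrow> n \<bullet> (y - x) \<le> 0"
      "\<And>w. n \<bullet> w < 0 \<Longrightarrow> \<forall>\<^sub>F t in at_right 0. x + t *\<^sub>R w \<in> K"
    using C1_boundary_normal K by blast
  define a where "a = n - (n \<bullet> \<nu>) *\<^sub>R \<nu>"
  have a\<nu>: "a \<bullet> \<nu> = 0"
    by (simp add: a_def inner_simps \<nu>\<nu>)
  \<comment> \<open>A normal parallel to \<nu> would put \<open>K\<close> on one side of the slicing
    hyperplane, but \<open>y\<close> and \<open>z\<close> lie strictly on opposite sides.\<close>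
  have "a \<noteq> 0"
  proof
    assume "a = 0"
    then have eq: "n = (n \<bullet> \<nu>) *\<^sub>R \<nu>"
      by (simp add: a_def)
    have "n \<bullet> (v - x) = (n \<bullet> \<nu>) * (v \<bullet> \<nu> - p)" for v
      by (subst eq) (simp add: inner_simps inner_commute xp[symmetric])
    then have "(n \<bullet> \<nu>) * (y \<bullet> \<nu> - p) \<le> 0" "(n \<bullet> \<nu>) * (z \<bullet> \<nu> - p) \<le> 0"
      using n(2) y(1) z(1) by metis+
    then have "n \<bullet> \<nu> = 0"
      using y(2) z(2) by (auto simp: mult_le_0_iff)
    with eq n(1) show False
      by simp
  qed
  \<comment> \<open>Both \<open>a\<close> and \<open>u\<close> are orthogonal to \<nu>, hence so is
    \<open>w\<close>; it runs parallel to the slice and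
    \<open>n \<bullet> w = a \<bullet> w\<close>.\<close>
  moreover have "u \<bullet> w \<le> 0" if w: "w \<in> span {a, u}" and neg: "a \<bullet> w < 0" for w
  proof -
    have "w \<bullet> \<nu> = 0"
      using w span_minimal[OF _ subspace_hyperplane[of \<nu>], of "{a, u}"] a\<nu> u(1)
      by (auto simp: inner_commute)
    moreover from this have "n \<bullet> w < 0"
      using neg by (simp add: a_def inner_simps inner_commute)
    ultimately show ?thesis
      using maximal[OF n(3), of w] by (simp add: inner_commute)
  qed
  ultimately obtain c where c: "c > 0" "a = c *\<^sub>R u"
    using positive_multiple_of_halfspace u(2) by blast
  define s where "s = - (n \<bullet> \<nu>) / c"
  have n_eq: "n = c *\<^sub>R (u - s *\<^sub>R \<nu>)"
    using c by (simp add: a_def s_def algebra_simps)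
  show thesis
  proof
    fix y assume "y \<in> K"
    then have "c * ((y - x) \<bullet> (u - s *\<^sub>R \<nu>)) \<le> 0"
      using n(2) by (simp add: n_eq inner_commute)
    then show "y \<bullet> (u - s *\<^sub>R \<nu>) \<le> x \<bullet> (u - s *\<^sub>R \<nu>)"
      using c(1) by (simp add: mult_le_0_iff inner_diff_left)
  next
    fix w assume "w \<bullet> (u - s *\<^sub>R \<nu>) < 0"
    then have "n \<bullet> w < 0"
      using c(1) by (simp add: n_eq inner_commute mult_less_0_iff)
    then show "\<forall>\<^sub>F t in at_right 0. x + t *\<^sub>R w \<in> K"
      by (rule n(3))
  qed
qed

section \<open>Differentiability in the height of the slice\<close>

text \<open>Bounding the extended-real value itself also yields finiteness near
  \<open>p\<close>.\<close>

lemma slicing_support_local_bounds: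
  fixes K :: "'a::euclidean_space set"
  assumes \<nu>: "norm \<nu> = 1" and u: "u \<bullet> \<nu> = 0" "u \<noteq> 0" and xp: "x \<in> slice K \<nu> p"
    and le: "\<And>y. y \<in> K \<Longrightarrow> y \<bullet> (u - s *\<^sub>R \<nu>) \<le> x \<bullet> (u - s *\<^sub>R \<nu>)"
    and inside: "\<And>w. w \<bullet> (u - s *\<^sub>R \<nu>) < 0 \<Longrightarrow> \<forall>\<^sub>F t in at_right 0. x + t *\<^sub>R w \<in> K"
    and "\<epsilon> > 0"
  shows "\<forall>\<^sub>F q in nhds p.
    slicing_support_function K \<nu> u q \<in>
      {ereal (x \<bullet> u + s * (q - p) - \<epsilon> * \<bar>q - p\<bar>)..ereal (x \<bullet> u + s * (q - p))}"
proof -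
  have \<nu>\<nu>: "\<nu> \<bullet> \<nu> = 1" and uu: "u \<bullet> u \<noteq> 0" and u\<nu>: "\<nu> \<bullet> u = 0" and x\<nu>: "x \<bullet> \<nu> = p"
    using \<nu> u xp by (auto simp: dot_square_norm inner_commute slice_def)
  \<comment> \<open>This is the supporting half-space at \<open>x\<close> read on height
    \<open>q\<close>; it holds for every \<open>q\<close>, empty slices included.\<close>
  have upper: "slicing_support_function K \<nu> u q \<le> ereal (x \<bullet> u + s * (q - p))" for q
    unfolding slicing_support_function_def
  proof (rule SUP_least)
    fix y assume "y \<in> slice K \<nu> q"
    then have "y \<in> K" "y \<bullet> \<nu> = q"
      by (auto simp: slice_def)
    then show "ereal (y \<bullet> u) \<le> ereal (x \<bullet> u + s * (q - p))"
      using le[of y] x\<nu> by (simp add: inner_simps algebra_simps)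
  qed
  have lower: "\<forall>\<^sub>F t in at_right 0.
      ereal (x \<bullet> u + t * (\<sigma> * s - \<epsilon>)) \<le> slicing_support_function K \<nu> u (p + \<sigma> * t)" for \<sigma>
  proof -
    \<comment> \<open>The first term moves the height at rate \<sigma>; the second is chosen so that
      \<open>w \<bullet> (u - s *\<^sub>R \<nu>) = - \<epsilon>\<close>, which points into
      \<open>K\<close>. The values 1 and -1 of \<sigma> treat the two sides of
      \<open>p\<close>.\<close>
    define w where "w = \<sigma> *\<^sub>R \<nu> + ((\<sigma> * s - \<epsilon>) / (u \<bullet> u)) *\<^sub>R u"
    have w: "w \<bullet> u = \<sigma> * s - \<epsilon>" "w \<bullet> \<nu> = \<sigma>"
      using uu u(1) by (simp_all add: w_def inner_simps u\<nu> \<nu>\<nu>)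
    then have "w \<bullet> (u - s *\<^sub>R \<nu>) < 0"
      using \<open>\<epsilon> > 0\<close> by (simp add: inner_simps)
    then have "\<forall>\<^sub>F t in at_right 0. x + t *\<^sub>R w \<in> K"
      by (rule inside)
    then show ?thesis
    proof eventually_elim
      case (elim t)
      then have "x + t *\<^sub>R w \<in> slice K \<nu> (p + \<sigma> * t)"
        by (simp add: slice_def inner_simps w x\<nu>)
      then have "ereal ((x + t *\<^sub>R w) \<bullet> u) \<le> slicing_support_function K \<nu> u (p + \<sigma> * t)"
        unfolding slicing_support_function_def by (rule SUP_upper)
      then show ?case
        by (simp add: inner_simps w)
    qed
  qed
  let ?P = "\<lambda>q. ereal (x \<bullet> u + s * (q - p) - \<epsilon> * \<bar>q - p\<bar>) \<le> slicing_support_function K \<nu> u q"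
  have "\<forall>\<^sub>F t in at_right 0. ?P (p + t)"
    using lower[of 1] eventually_at_right_less[of 0]
    by eventually_elim (simp add: algebra_simps)
  then have "eventually ?P (at_right p)"
    by (subst at_right_to_0) (simp add: eventually_filtermap add.commute)
  moreover have "\<forall>\<^sub>F t in at_right 0. ?P (p - t)"
    using lower[of "-1"] eventually_at_right_less[of 0]
    by eventually_elim (simp add: algebra_simps)
  then have "eventually ?P (at_left p)"
    by (subst at_left_minus, subst at_right_to_0)
      (simp add: eventually_filtermap filtermap_filtermap add.commute)
  moreover have "?P p"
    unfolding slicing_support_function_def using xp by (auto intro: SUP_upper)
  ultimately have "eventually ?P (nhds p)"
    by (simp add: eventually_nhds_conv_at eventually_at_split)
  then show ?thesis
    by (rule eventually_mono) (use upper in simp)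
qed

text \<open>A squeeze: for \<open>q\<close> near \<open>p\<close> the difference quotient is within
  \<epsilon> of \<open>s\<close>.\<close>

lemma ereal_deriv_of_local_bounds:
  assumes bounds: "\<And>\<epsilon>. \<epsilon> > 0 \<Longrightarrow> \<forall>\<^sub>F q in nhds p.
      f q \<in> {ereal (a + s * (q - p) - \<epsilon> * \<bar>q - p\<bar>)..ereal (a + s * (q - p))}"
  shows "ereal_differentiable_at f p" and "ereal_deriv f p = s"
proof -
  have fin: "\<forall>\<^sub>F q in nhds p. \<bar>f q\<bar> \<noteq> \<infinity>"
    using bounds[of 1] by (rule eventually_mono) auto
  \<comment> \<open>At \<open>q = p\<close> the two bounds coincide.\<close>
  have fp: "f p = ereal a"
    using eventually_nhds_x_imp_x[OF bounds[of 1]] by simp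
  have "((\<lambda>q. (real_of_ereal (f q) - a) / (q - p)) \<longlongrightarrow> s) (at p)"
  proof (rule tendstoI)
    fix e :: real assume "e > 0"
    then have "\<forall>\<^sub>F q in nhds p.
        f q \<in> {ereal (a + s * (q - p) - (e/2) * \<bar>q - p\<bar>)..ereal (a + s * (q - p))}"
      by (intro bounds) simp
    then have "\<forall>\<^sub>F q in at p.
        f q \<in> {ereal (a + s * (q - p) - (e/2) * \<bar>q - p\<bar>)..ereal (a + s * (q - p))}"
      by (simp add: eventually_nhds_conv_at)
    moreover have "\<forall>\<^sub>F q in at p. q \<noteq> p"
      by (simp add: eventually_at_filter)
    ultimately show "\<forall>\<^sub>F q in at p. dist ((real_of_ereal (f q) - a) / (q - p)) s < e"
    proof eventually_elim
      case (elim q)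
      then obtain r where r: "f q = ereal r"
        by (cases "f q") auto
      have "\<bar>r - a - s * (q - p)\<bar> \<le> (e/2) * \<bar>q - p\<bar>"
        using elim r by auto
      also have "\<dots> < e * \<bar>q - p\<bar>"
        using elim \<open>e > 0\<close> by simp
      finally have "\<bar>r - a - s * (q - p)\<bar> / \<bar>q - p\<bar> < e"
        using elim by (simp add: pos_divide_less_eq)
      moreover have "(r - a) / (q - p) - s = (r - a - s * (q - p)) / (q - p)"
        using elim by (simp add: field_simps)
      ultimately show ?case
        by (simp add: dist_real_def r abs_divide)
    qed
  qed
  then have D: "((\<lambda>q. real_of_ereal (f q)) has_real_derivative s) (at p)"
    by (simp add: has_field_derivative_iff fp)
  then show "ereal_differentiable_at f p" "ereal_deriv f p = s"
    using fin DERIV_imp_deriv[OF D]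
    by (auto simp: ereal_differentiable_at_def ereal_deriv_def real_differentiable_def)
qed

section \<open>The identity for the support function\<close>

theorem theorem5:
  fixes K :: "'a::euclidean_space set" and \<nu> u :: 'a and p m M :: real
  assumes "convex_body K" and "strictly_convex_set K" and "C1_boundary K"
    and "norm \<nu> = 1"
    and "u \<bullet> \<nu> = 0" and "u \<noteq> 0"
    and "m = (LEAST t. t \<in> (\<lambda>x. x \<bullet> \<nu>) ` K)"
    and "M = (GREATEST t. t \<in> (\<lambda>x. x \<bullet> \<nu>) ` K)"
    and "m < p" and "p < M"
  shows "ereal_differentiable_at (slicing_support_function K \<nu> u) p \<and>
    ereal (support_function K (u - ereal_deriv (slicing_support_function K \<nu> u) p *\<^sub>R \<nu>)) =
      slicing_support_function K \<nu> u p
        - ereal (p * ereal_deriv (slicing_support_function K \<nu> u) p)"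
proof -
  have K: "compact K" "convex K" "K \<noteq> {}"
    using assms(1) interior_subset by (auto simp: convex_body_def)
  have cont: "continuous_on K (\<lambda>x. x \<bullet> \<nu>)"
    by (intro continuous_intros)
  obtain y where y: "y \<in> K" "\<And>v. v \<in> K \<Longrightarrow> y \<bullet> \<nu> \<le> v \<bullet> \<nu>"
    using continuous_attains_inf[OF K(1,3) cont] by blast
  obtain z where z: "z \<in> K" "\<And>v. v \<in> K \<Longrightarrow> v \<bullet> \<nu> \<le> z \<bullet> \<nu>"
    using continuous_attains_sup[OF K(1,3) cont] by blast
  have "m = y \<bullet> \<nu>" "M = z \<bullet> \<nu>"
    unfolding assms(7,8) using y z by (auto intro!: Least_equality Greatest_equality)
  with assms(9,10) have yp: "y \<bullet> \<nu> < p" and pz: "p < z \<bullet> \<nu>"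
    by auto
  \<comment> \<open>\<open>K\<close> is connected and has points below and above height
    \<open>p\<close>.\<close>
  have "slice K \<nu> p \<noteq> {}"
    using connected_ivt_hyperplane[OF convex_connected[OF K(2)] y(1) z(1), of \<nu> p] yp pz
    by (auto simp: slice_def inner_commute)
  then obtain x where x: "x \<in> slice K \<nu> p"
      and max: "\<And>y. y \<in> slice K \<nu> p \<Longrightarrow> y \<bullet> u \<le> x \<bullet> u"
    using slice_maximum K(1) by blast
  obtain s where s: "\<And>y. y \<in> K \<Longrightarrow> y \<bullet> (u - s *\<^sub>R \<nu>) \<le> x \<bullet> (u - s *\<^sub>R \<nu>)"
      "\<And>w. w \<bullet> (u - s *\<^sub>R \<nu>) < 0 \<Longrightarrow> \<forall>\<^sub>F t in at_right 0. x + t *\<^sub>R w \<in> K"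
    using slicing_support_normal[OF compact_imp_closed[OF K(1)] K(2) assms(3-6)
        y(1) yp z(1) pz x max] by blast
  note bounds = slicing_support_local_bounds[OF assms(4-6) x s]
  \<comment> \<open>The maximiser \<open>x\<close> of the slice also maximises the product with
    \<open>u - s *\<^sub>R \<nu>\<close> over all of \<open>K\<close>.\<close>
  have "support_function K (u - s *\<^sub>R \<nu>) = x \<bullet> (u - s *\<^sub>R \<nu>)"
    unfolding support_function_def
    using x s(1) by (intro cSup_eq_maximum) (auto simp: slice_def)
  also have "\<dots> = x \<bullet> u - p * s"
    using x by (simp add: slice_def inner_simps)
  finally show ?thesis
    using slicing_support_maximum[OF x max] ereal_deriv_of_local_bounds[OF bounds]
    by simp
qed

end
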